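(* Algorithm BroadcastCC with threshold parameter $s$ (a natural number, $s\ge 2$), described in the context, solves the spanning forest problem in the broadcast congested clique in $O(s+\log_s n)$ rounds for an $n$-node graph.
   Context: Model. $n$ nodes with unique IDs in $[n]=\{1,\dots,n\}$ form a fully connected synchronous network. In each round of the broadcast congested clique every node sends one message of $O(\log n)$ bits, the same to all other nodes; local computation is free. Input and problem. The input is an undirected $n$-node graph $G=(V,E)$ whose nodes are identified with the nodes of the network. Each node initially knows $n$, its own ID and the IDs of its neighbors in $G$. At the end every node must know a set of edges of $G$ forming a spanning forest of $G$ (inducing its connected components). Notions. During the algorithm nodes are active or deactivated. A partition $\mathcal{C}$ of the set of active nodes into components (connected by edges already known to all nodes) is known to all nodes; $C^v$ is the component containing $v$. With respect to the current partition of the active nodes, $N(v)=\{C\in\mathcal{C} : C\ne C^v,\ (v,u)\in E \text{ for some } u\in C\}$, $\deg(v)=|N(v)|$, and $\deg(C)=\max_{v\in C}\deg(v)$. Components are linearly ordered: $C\succ C'$ iff $\deg(C)>\deg(C')$, or $\deg(C)=\deg(C')$ and $\mathrm{ID}(C)>\mathrm{ID}(C')$. A component is a local maximum if all its neighboring components are smaller with respect to $\succ$. Algorithm BroadcastCC with parameter $s$. At the beginning all nodes are active and each forms a separate component. While there are active components, the following phase is executed (described for a node $v$). Round 1: $v$ broadcasts $\deg(v)$. Round 2: if $\deg(v)>0$ and $C^v$ is not a local maximum, $v$ broadcasts an edge $(u,v)$ with $u\in C_{\max}(v)$, where $C_{\max}(v)$ is the largest element of $N(v)$ with respect to $\succ$.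 Round 3: if $\deg(v)>0$ and $C^v$ is a local maximum, let $N_{\mathrm{lost}}(v)$ be the set of those $C\in N(v)$ for which no edge connecting $C$ and $C^v$ was broadcast; if $N_{\mathrm{lost}}(v)\neq\emptyset$, then $v$ broadcasts an edge $(u,v)$ with $u\in C$ for some $C\in N_{\mathrm{lost}}(v)$. Then $v$ computes the new partition into components, using the broadcast edges. Round 4: $v$ broadcasts $\deg(v)$ with respect to the new components; if $\deg(C^v)<s$, then $v$ is deactivated. After the while-loop comes the Playoff, lasting $s$ rounds, in which each node $v$ of each deactivated component broadcasts edges going to all components connected to $v$ (there are at most $s$ such components for each deactivated node).
   Formalization: After Round 1 a node cannot know whether its component is a local maximum, so each phase has one extra round between Rounds 1 and 2 in which every active node announces with one bit whether it sees a larger neighboring component; a phase thus has five rounds instead of four. *)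

theory Defs
  imports Complex_Main "HOL-Library.FuncSet"
begin

section \<open>Simple graphs on the node set \<open>{1..n}\<close>\<close>

definition simple_graph :: "nat \<Rightarrow> nat set set \<Rightarrow> bool" where
  "simple_graph n E \<longleftrightarrow> (\<forall>e\<in>E. \<exists>u v. u \<in> {1..n} \<and> v \<in> {1..n} \<and> u \<noteq> v \<and> e = {u, v})"

definition neighbors :: "nat set set \<Rightarrow> nat \<Rightarrow> nat set" where
  "neighbors E v = {u. {u, v} \<in> E}"

definition reachable_in :: "nat set \<Rightarrow> nat set set \<Rightarrow> (nat \<times> nat) set" where
  "reachable_in W B = {(u, v). u \<in> W \<and> v \<in> W \<and> {u, v} \<in> B}\<^sup>*"

definition components :: "nat set \<Rightarrow> nat set set \<Rightarrow> nat set set" where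
  "components W B = (\<lambda>v. {u \<in> W. (v, u) \<in> reachable_in W B}) ` W"

definition is_cycle :: "nat set set \<Rightarrow> nat list \<Rightarrow> bool" where
  "is_cycle F p \<longleftrightarrow> length p \<ge> 3 \<and> distinct p \<and>
     (\<forall>i < length p. {p ! i, p ! (Suc i mod length p)} \<in> F)"

definition spanning_forest :: "nat \<Rightarrow> nat set set \<Rightarrow> nat set set \<Rightarrow> bool" where
  "spanning_forest n E F \<longleftrightarrow>
     F \<subseteq> E \<and> (\<nexists>p. is_cycle F p) \<and> components {1..n} F = components {1..n} E"


section \<open>The broadcast congested clique\<close>

text \<open>
  Local computation is free, so the state of a node is simply all it has seen: its input and the
  messages broadcast so far. Here \<open>heard V ! i\<close> maps each node of \<open>{1..n}\<close> to the
  message it broadcast in the \<open>i\<close>-th round (counted from 0), the node's own messages included.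
\<close>

record 'm view =
  num_nodes :: nat
  own_id :: nat
  own_nbrs :: "nat set"
  heard :: "(nat \<Rightarrow> 'm) list"

text \<open>\<open>result\<close> is \<open>None\<close> as long as the node is still running.\<close>

record ('m, 'o) bcc_algorithm =
  message :: "'m view \<Rightarrow> 'm"
  result :: "'m view \<Rightarrow> 'o option"

definition view_of :: "nat \<Rightarrow> nat set set \<Rightarrow> (nat \<Rightarrow> 'm) list \<Rightarrow> nat \<Rightarrow> 'm view" where
  "view_of n E H v = \<lparr>num_nodes = n, own_id = v, own_nbrs = neighbors E v, heard = H\<rparr>"

fun transcript ::
  "('m, 'o) bcc_algorithm \<Rightarrow> nat \<Rightarrow> nat set set \<Rightarrow> nat \<Rightarrow> (nat \<Rightarrow> 'm) list" where
  "transcript A n E 0 = []"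
| "transcript A n E (Suc r) =
     transcript A n E r @ [\<lambda>v\<in>{1..n}. message A (view_of n E (transcript A n E r) v)]"

text \<open>
  On input \<open>E\<close>, all nodes stop after the same number \<open>r \<le> T\<close> of rounds, all with
  the same correct result, and every message broadcast has at most \<open>b\<close> bits under the
  encoding \<open>enc\<close>.
\<close>

definition bcc_solves ::
  "('m, 'o) bcc_algorithm \<Rightarrow> ('m \<Rightarrow> bool list) \<Rightarrow> nat \<Rightarrow> nat set set
     \<Rightarrow> ('o \<Rightarrow> bool) \<Rightarrow> real \<Rightarrow> real \<Rightarrow> bool" where
  "bcc_solves A enc n E correct b T \<longleftrightarrow>
     (\<exists>r out. real r \<le> T \<and> correct out \<and>
        (\<forall>v\<in>{1..n}.
           result A (view_of n E (transcript A n E r) v) = Some out \<and>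
           (\<forall>i<r. result A (view_of n E (transcript A n E i) v) = None \<and>
                  real (length (enc (message A (view_of n E (transcript A n E i) v)))) \<le> b)))"


section \<open>Algorithm BroadcastCC\<close>

datatype msg = Silent | Degree nat | Sees_Larger bool | Edge nat nat

definition broadcast_edges :: "nat \<Rightarrow> (nat \<Rightarrow> msg) \<Rightarrow> nat set set" where
  "broadcast_edges n m = {{u, v} | u v. \<exists>w\<in>{1..n}. m w = Edge u v}"

definition degree_in :: "(nat \<Rightarrow> msg) \<Rightarrow> nat \<Rightarrow> nat" where
  "degree_in m v = (case m v of Degree d \<Rightarrow> d | _ \<Rightarrow> 0)"

definition comp_of :: "nat set set \<Rightarrow> nat \<Rightarrow> nat set" where
  "comp_of P v = (THE C. C \<in> P \<and> v \<in> C)"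

text \<open>\<open>nbr_comps P N v\<close> is $N(v)$ for the partition \<open>P\<close>, where \<open>N\<close> is the set of
  neighbors of \<open>v\<close> in the input graph.\<close>

definition nbr_comps :: "nat set set \<Rightarrow> nat set \<Rightarrow> nat \<Rightarrow> nat set set" where
  "nbr_comps P N v = {C \<in> P. C \<noteq> comp_of P v \<and> (\<exists>u\<in>C. u \<in> N)}"

definition comp_degree :: "(nat \<Rightarrow> nat) \<Rightarrow> nat set \<Rightarrow> nat" where
  "comp_degree d C = Max (d ` C)"

text \<open>The ID of a component is the smallest ID of its nodes.\<close>

definition larger :: "(nat \<Rightarrow> nat) \<Rightarrow> nat set \<Rightarrow> nat set \<Rightarrow> bool" where
  "larger d C C' \<longleftrightarrow> comp_degree d C > comp_degree d C' \<or>
     (comp_degree d C = comp_degree d C' \<and> Min C > Min C')"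

definition largest :: "(nat \<Rightarrow> nat) \<Rightarrow> nat set set \<Rightarrow> nat set" where
  "largest d S = (THE C. C \<in> S \<and> (\<forall>C'\<in>S. C' \<noteq> C \<longrightarrow> larger d C C'))"

text \<open>
  The state of the algorithm between two phases, which is common knowledge: the active nodes, all
  edges broadcast so far, and for each deactivated node the partition at the time of its
  deactivation (which, in that node's last phase, still includes the components deactivated
  together with it). The components of the active nodes are determined by the first two.
\<close>

record state =
  active :: "nat set"
  known :: "nat set set"
  exit_part :: "nat \<Rightarrow> nat set set"

definition initial_state :: "nat \<Rightarrow> state" where
  "initial_state n = \<lparr>active = {1..n}, known = {}, exit_part = (\<lambda>_. {})\<rparr>"

definition current_part :: "state \<Rightarrow> nat set set" where
  "current_part S = components (active S) (known S)"

definition merged_part :: "nat \<Rightarrow> state \<Rightarrow> (nat \<Rightarrow> msg) \<Rightarrow> (nat \<Rightarrow> msg) \<Rightarrow> nat set set" where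
  "merged_part n S m2 m3 =
     components (active S) (known S \<union> broadcast_edges n m2 \<union> broadcast_edges n m3)"

text \<open>
  Rounds 1 to 4 of a phase have messages \<open>m1\<close> to \<open>m4\<close>. A node sees only its own neighbors,
  hence from the degrees alone it cannot tell whether its component is a local maximum. So between
  Rounds 1 and 2 there is a round \<open>m1'\<close> in which each active node announces, with one bit,
  whether one of its own neighboring components is larger than its component.
\<close>

definition next_state ::
  "nat \<Rightarrow> nat \<Rightarrow> state \<Rightarrow> (nat \<Rightarrow> msg) \<Rightarrow> (nat \<Rightarrow> msg) \<Rightarrow> (nat \<Rightarrow> msg) \<Rightarrow> state" where
  "next_state s n S m2 m3 m4 =
     (let P = merged_part n S m2 m3;
          D = {v \<in> active S. comp_degree (degree_in m4) (comp_of P v) < s}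
      in \<lparr>active = active S - D,
          known = known S \<union> broadcast_edges n m2 \<union> broadcast_edges n m3,
          exit_part = (\<lambda>v. if v \<in> D then P else exit_part S v)\<rparr>)"

text \<open>
  \<open>locate\<close> reads a transcript: it returns the state at the beginning of the unfinished phase (or
  of the Playoff) together with the rounds of that phase (or of the Playoff) heard so far.
\<close>

fun locate ::
  "nat \<Rightarrow> nat \<Rightarrow> state \<Rightarrow> (nat \<Rightarrow> msg) list \<Rightarrow> state \<times> (nat \<Rightarrow> msg) list" where
  "locate s n S (m1 # m1' # m2 # m3 # m4 # H) =
     (if active S = {} then (S, m1 # m1' # m2 # m3 # m4 # H)
      else locate s n (next_state s n S m2 m3 m4) H)"
| "locate s n S H = (S, H)"

definition is_local_max :: "(nat \<Rightarrow> msg) \<Rightarrow> nat set \<Rightarrow> bool" where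
  "is_local_max m1' C \<longleftrightarrow> (\<forall>v\<in>C. m1' v \<noteq> Sees_Larger True)"

text \<open>
  \<open>pick\<close> resolves the choices left open by the algorithm: \<open>pick V X\<close> is the neighbor
  that a node with view \<open>V\<close> chooses from a nonempty set \<open>X\<close> of admissible ones.
\<close>

type_synonym pick_rule = "msg view \<Rightarrow> nat set \<Rightarrow> nat"

definition round1_msg :: "nat set set \<Rightarrow> nat set \<Rightarrow> nat \<Rightarrow> msg" where
  "round1_msg P N v = Degree (card (nbr_comps P N v))"

definition round1'_msg ::
  "nat set set \<Rightarrow> (nat \<Rightarrow> msg) \<Rightarrow> nat set \<Rightarrow> nat \<Rightarrow> msg" where
  "round1'_msg P m1 N v =
     Sees_Larger (\<exists>C \<in> nbr_comps P N v. larger (degree_in m1) C (comp_of P v))"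

definition round2_msg ::
  "(nat set \<Rightarrow> nat) \<Rightarrow> nat set set \<Rightarrow> (nat \<Rightarrow> msg) \<Rightarrow> (nat \<Rightarrow> msg) \<Rightarrow> nat set \<Rightarrow> nat \<Rightarrow> msg" where
  "round2_msg pck P m1 m1' N v =
     (if nbr_comps P N v \<noteq> {} \<and> \<not> is_local_max m1' (comp_of P v)
      then Edge (pck (largest (degree_in m1) (nbr_comps P N v) \<inter> N)) v
      else Silent)"

definition lost_comps ::
  "nat \<Rightarrow> nat set set \<Rightarrow> (nat \<Rightarrow> msg) \<Rightarrow> nat set \<Rightarrow> nat \<Rightarrow> nat set set" where
  "lost_comps n P m2 N v =
     {C \<in> nbr_comps P N v.
        \<not> (\<exists>x\<in>C. \<exists>y\<in>comp_of P v. {x, y} \<in> broadcast_edges n m2)}"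

definition round3_msg ::
  "(nat set \<Rightarrow> nat) \<Rightarrow> nat \<Rightarrow> nat set set \<Rightarrow> (nat \<Rightarrow> msg) \<Rightarrow> (nat \<Rightarrow> msg) \<Rightarrow> nat set \<Rightarrow> nat
     \<Rightarrow> msg" where
  "round3_msg pck n P m1' m2 N v =
     (if nbr_comps P N v \<noteq> {} \<and> is_local_max m1' (comp_of P v) \<and> lost_comps n P m2 N v \<noteq> {}
      then Edge (pck (\<Union>(lost_comps n P m2 N v) \<inter> N)) v
      else Silent)"

text \<open>
  In the Playoff, a node broadcasts, one per round, an edge to each component that was adjacent to
  it at the time of its deactivation. \<open>H\<close> lists the earlier rounds of the Playoff.
\<close>

definition uncovered_comps ::
  "state \<Rightarrow> (nat \<Rightarrow> msg) list \<Rightarrow> nat set \<Rightarrow> nat \<Rightarrow> nat set set" where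
  "uncovered_comps S H N v =
     {C \<in> nbr_comps (exit_part S v) N v. \<not> (\<exists>m \<in> set H. \<exists>u\<in>C. m v = Edge u v)}"

definition playoff_msg ::
  "(nat set \<Rightarrow> nat) \<Rightarrow> state \<Rightarrow> (nat \<Rightarrow> msg) list \<Rightarrow> nat set \<Rightarrow> nat \<Rightarrow> msg" where
  "playoff_msg pck S H N v =
     (if uncovered_comps S H N v \<noteq> {}
      then Edge (pck (\<Union>(uncovered_comps S H N v) \<inter> N)) v
      else Silent)"

definition broadcast_cc_message :: "nat \<Rightarrow> pick_rule \<Rightarrow> msg view \<Rightarrow> msg" where
  "broadcast_cc_message s pick V =
     (let n = num_nodes V; v = own_id V; N = own_nbrs V;
          (S, H) = locate s n (initial_state n) (heard V);
          P = current_part S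
      in if active S = {} then playoff_msg (pick V) S H N v
         else if v \<notin> active S then Silent
         else case H of
             [] \<Rightarrow> round1_msg P N v
           | [m1] \<Rightarrow> round1'_msg P m1 N v
           | [m1, m1'] \<Rightarrow> round2_msg (pick V) P m1 m1' N v
           | [m1, m1', m2] \<Rightarrow> round3_msg (pick V) n P m1' m2 N v
           | [m1, m1', m2, m3] \<Rightarrow> round1_msg (merged_part n S m2 m3) N v
           | _ \<Rightarrow> Silent)"

text \<open>
  After the \<open>s\<close> rounds of the Playoff, every node extracts (in the same way) a spanning forest
  of the graph formed by all broadcast edges.
\<close>

definition broadcast_cc_result :: "nat \<Rightarrow> msg view \<Rightarrow> nat set set option" where
  "broadcast_cc_result s V =
     (let n = num_nodes V;
          (S, H) = locate s n (initial_state n) (heard V)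
      in if active S = {} \<and> length H \<ge> s
         then Some (SOME F. spanning_forest n (known S \<union> \<Union>(broadcast_edges n ` set H)) F)
         else None)"

definition broadcast_cc :: "nat \<Rightarrow> pick_rule \<Rightarrow> (msg, nat set set) bcc_algorithm" where
  "broadcast_cc s pick =
     \<lparr>message = broadcast_cc_message s pick, result = broadcast_cc_result s\<rparr>"

end

theory Submission
  imports Defs "HOL-Library.Nat_Bijection"
begin

text \<open>
  In a phase, consider a component of the new partition with a node that still has at least
  \<open>s\<close> neighboring components, and let \<open>C\<close> be the largest of the old components merged into it;
  then \<open>C\<close> has degree at least \<open>s\<close>. No node of the new component broadcasts an edge to an
  old component larger than \<open>C\<close>. Hence \<open>C\<close> is a local maximum, and each neighboring component
  is connected to it in Round 2: otherwise a lost one would be attached in Round 3, although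
  it has itself broadcast an edge to something larger than \<open>C\<close>. So at least \<open>s + 1\<close> old
  components are merged, and after \<open>j\<close> phases every active component has at least
  \<open>(s + 1) ^ j\<close> nodes, which bounds the number of phases by \<open>log s n + 1\<close>.

  An edge of the input graph is seen by whichever of its endpoints is deactivated first. That
  endpoint then has fewer than \<open>s\<close> neighboring components, so the Playoff connects it to
  the component of the other one. A spanning forest of the broadcast edges is therefore one of the
  input graph.
\<close>

section \<open>Connectivity\<close>

lemma reachable_in_refl [simp]: "(v, v) \<in> reachable_in W B"
  by (simp add: reachable_in_def)

lemma reachable_in_trans:
  "(u, v) \<in> reachable_in W B \<Longrightarrow> (v, w) \<in> reachable_in W B \<Longrightarrow> (u, w) \<in> reachable_in W B"
  unfolding reachable_in_def by (rule rtrancl_trans)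

lemma reachable_in_sym: "(u, v) \<in> reachable_in W B \<Longrightarrow> (v, u) \<in> reachable_in W B"
proof -
  have "sym {(u, v). u \<in> W \<and> v \<in> W \<and> {u, v} \<in> B}"
    by (auto simp: sym_def insert_commute)
  then show "(u, v) \<in> reachable_in W B \<Longrightarrow> (v, u) \<in> reachable_in W B"
    unfolding reachable_in_def by (meson sym_rtrancl symE)
qed

lemma reachable_in_edge: "{u, v} \<in> B \<Longrightarrow> u \<in> W \<Longrightarrow> v \<in> W \<Longrightarrow> (u, v) \<in> reachable_in W B"
  unfolding reachable_in_def by (rule r_into_rtrancl) simp

text \<open>Reachability is reflexive and transitive, so it is enough to check single edges. Both
  deleting a cycle edge and replacing \<open>E\<close> by the broadcast edges are handled this
  way.\<close>

lemma reachable_in_subsetI: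
  assumes "\<And>u v. u \<in> W \<Longrightarrow> v \<in> W \<Longrightarrow> {u, v} \<in> B \<Longrightarrow> (u, v) \<in> reachable_in W' B'"
  shows "reachable_in W B \<subseteq> reachable_in W' B'"
proof -
  have "(u, v) \<in> reachable_in W' B'" if "(u, v) \<in> reachable_in W B" for u v
    using that unfolding reachable_in_def[of W B]
  proof (induction rule: rtrancl_induct)
    case (step y z)
    then show ?case
      using assms[of y z] reachable_in_trans[of u y W' B' z] by simp
  qed simp
  then show ?thesis
    by auto
qed

lemma reachable_in_mono: "W \<subseteq> W' \<Longrightarrow> B \<subseteq> B' \<Longrightarrow> reachable_in W B \<subseteq> reachable_in W' B'"
  by (rule reachable_in_subsetI) (blast intro: reachable_in_edge)

lemma components_cong_reachable:
  "reachable_in W B = reachable_in W B' \<Longrightarrow> components W B = components W B'"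
  by (simp add: components_def)

lemma component_mem_iff:
  assumes "C \<in> components W B" "v \<in> C"
  shows "u \<in> C \<longleftrightarrow> u \<in> W \<and> (v, u) \<in> reachable_in W B"
proof -
  obtain w where w: "C = {u \<in> W. (w, u) \<in> reachable_in W B}"
    using assms(1) unfolding components_def by blast
  then have "(w, v) \<in> reachable_in W B"
    using assms(2) by blast
  then have "(w, u) \<in> reachable_in W B \<longleftrightarrow> (v, u) \<in> reachable_in W B"
    using reachable_in_trans reachable_in_sym by metis
  then show ?thesis
    using w by blast
qed

lemma component_subset: "C \<in> components W B \<Longrightarrow> C \<subseteq> W"
  by (auto simp: components_def)

lemma component_nonempty: "C \<in> components W B \<Longrightarrow> C \<noteq> {}"
  by (auto simp: components_def)

lemma components_disjoint:
  assumes "C \<in> components W B" "C' \<in> components W B" "v \<in> C" "v \<in> C'"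
  shows "C = C'"
  using component_mem_iff[OF assms(1,3)] component_mem_iff[OF assms(2,4)] by blast

lemma comp_of_eq: "C \<in> components W B \<Longrightarrow> v \<in> C \<Longrightarrow> comp_of (components W B) v = C"
  unfolding comp_of_def by (rule the_equality) (blast, erule conjE, rule components_disjoint)

lemma comp_of_components:
  assumes "v \<in> W"
  shows "comp_of (components W B) v \<in> components W B" "v \<in> comp_of (components W B) v"
proof -
  have "{u \<in> W. (v, u) \<in> reachable_in W B} \<in> components W B"
    "v \<in> {u \<in> W. (v, u) \<in> reachable_in W B}"
    using assms by (auto simp: components_def)
  then show "comp_of (components W B) v \<in> components W B" "v \<in> comp_of (components W B) v"
    by (simp_all add: comp_of_eq)
qed

lemma finite_components: "finite W \<Longrightarrow> finite (components W B)"
  by (simp add: components_def)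

lemma finite_component: "finite W \<Longrightarrow> C \<in> components W B \<Longrightarrow> finite C"
  using component_subset finite_subset by metis

lemma card_components_le: "finite W \<Longrightarrow> card (components W B) \<le> card W"
  by (simp add: components_def card_image_le)

lemma comp_of_mono:
  assumes "v \<in> W" "B \<subseteq> B'"
  shows "comp_of (components W B) v \<subseteq> comp_of (components W B') v"
proof
  fix u
  assume "u \<in> comp_of (components W B) v"
  then have "u \<in> W" "(v, u) \<in> reachable_in W B"
    using component_mem_iff[OF comp_of_components[OF assms(1), of B]] by simp_all
  then show "u \<in> comp_of (components W B') v"
    using component_mem_iff[OF comp_of_components[OF assms(1), of B']]
      reachable_in_mono[OF order.refl assms(2), of W] by auto
qed

text \<open>A path that starts in a component inside \<open>W'\<close> never leaves that component,
  so it is also a path within \<open>W'\<close>. This is applied with the surviving nodes as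
  \<open>W'\<close>.\<close>

lemma components_restrict:
  assumes "W' \<subseteq> W" and closed: "\<And>C. C \<in> components W B \<Longrightarrow> C \<inter> W' \<noteq> {} \<Longrightarrow> C \<subseteq> W'"
  shows "components W' B \<subseteq> components W B"
proof
  fix C' assume C': "C' \<in> components W' B"
  then obtain v where v: "v \<in> C'" "v \<in> W'"
    using component_nonempty component_subset by blast
  define C where "C = comp_of (components W B) v"
  have C: "C \<in> components W B" "v \<in> C"
    using v assms(1) comp_of_components[of v W B] by (auto simp: C_def)
  have "C \<subseteq> W'"
    using closed[OF C(1)] C(2) v(2) by blast
  have "(v, u) \<in> reachable_in W' B" if "(v, u) \<in> reachable_in W B" for u
    using that unfolding reachable_in_def[of W B]
  proof (induction rule: rtrancl_induct)
    case (step y z)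
    have "y \<in> C" "z \<in> C"
      using step(1,2) component_mem_iff[OF C] rtrancl_into_rtrancl[OF step(1,2)]
      by (auto simp: reachable_in_def)
    then have "(y, z) \<in> reachable_in W' B"
      using step(2) \<open>C \<subseteq> W'\<close> by (auto intro: reachable_in_edge)
    then show ?case
      using step.IH reachable_in_trans by blast
  qed simp
  moreover have "(v, u) \<in> reachable_in W B" if "(v, u) \<in> reachable_in W' B" for u
    using that reachable_in_mono[OF assms(1) order.refl, of B] by blast
  ultimately have "C = C'"
    using component_mem_iff[OF C] component_mem_iff[OF C' v(1)] \<open>C \<subseteq> W'\<close> assms(1) by blast
  then show "C' \<in> components W B"
    using C by simp
qed


section \<open>Spanning forests\<close>

lemma simple_graph_edge:
  assumes "simple_graph n E" "{u, v} \<in> E"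
  shows "u \<in> {1..n}" "v \<in> {1..n}" "u \<noteq> v"
proof -
  obtain x y where "x \<in> {1..n}" "y \<in> {1..n}" "x \<noteq> y" "{u, v} = {x, y}"
    using assms unfolding simple_graph_def by blast
  then show "u \<in> {1..n}" "v \<in> {1..n}" "u \<noteq> v"
    by (auto simp: doubleton_eq_iff)
qed

lemma simple_graph_subset: "simple_graph n E \<Longrightarrow> F \<subseteq> E \<Longrightarrow> simple_graph n F"
  unfolding simple_graph_def by blast

lemma simple_graph_finite: "simple_graph n E \<Longrightarrow> finite E"
  by (rule finite_subset[of _ "Pow {1..n}"]) (auto simp: simple_graph_def)

text \<open>The closing edge of the cycle, between its last and first node, can go: the remaining
  cycle edges still lead from one to the other.\<close>

lemma cycle_edge_redundant:
  assumes F: "simple_graph n F" and p: "is_cycle F p"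
  shows "\<exists>e\<in>F. reachable_in {1..n} (F - {e}) = reachable_in {1..n} F"
proof -
  define l where "l = length p"
  define e where "e = {p ! (l - 1), p ! 0}"
  have l: "l \<ge> 3" and dist: "distinct p"
    and edge: "\<And>i. i < l \<Longrightarrow> {p ! i, p ! (Suc i mod l)} \<in> F"
    using p by (auto simp: is_cycle_def l_def)
  have e: "e \<in> F"
    using edge[of "l - 1"] l by (simp add: e_def)
  have walk: "(p ! 0, p ! i) \<in> reachable_in {1..n} (F - {e})" if "i < l" for i
    using that
  proof (induction i)
    case (Suc i)
    have "{p ! i, p ! Suc i} \<in> F"
      using edge[of i] Suc.prems by simp
    \<comment> \<open>Nodes determine their positions since \<open>p\<close> is distinct, so this
      could be the closing edge only if \<open>i = 0\<close> and \<open>l = 2\<close>, which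
      \<open>l \<ge> 3\<close> excludes.\<close>
    moreover have "{p ! i, p ! Suc i} \<noteq> e"
    proof
      assume "{p ! i, p ! Suc i} = e"
      then have "p ! i = p ! 0 \<and> p ! Suc i = p ! (l - 1) \<or> p ! Suc i = p ! 0"
        by (auto simp: e_def doubleton_eq_iff)
      then have "i = 0 \<and> Suc i = l - 1 \<or> Suc i = 0"
        using Suc.prems l nth_eq_iff_index_eq[OF dist, of i 0] nth_eq_iff_index_eq[OF dist, of "Suc i" 0]
          nth_eq_iff_index_eq[OF dist, of "Suc i" "l - 1"] unfolding l_def by linarith
      then show False
        using l by arith
    qed
    ultimately have "(p ! i, p ! Suc i) \<in> reachable_in {1..n} (F - {e})"
      using simple_graph_edge[OF F] by (blast intro: reachable_in_edge)
    then show ?case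
      using Suc reachable_in_trans by (meson Suc_lessD)
  qed simp
  have "(u, v) \<in> reachable_in {1..n} (F - {e})"
    if "{u, v} \<in> F" "u \<in> {1..n}" "v \<in> {1..n}" for u v
  proof (cases "{u, v} = e")
    case True
    then show ?thesis
      using walk[of "l - 1"] l reachable_in_sym by (auto simp: e_def doubleton_eq_iff)
  next
    case False
    then show ?thesis
      using that by (blast intro: reachable_in_edge)
  qed
  then have "reachable_in {1..n} F \<subseteq> reachable_in {1..n} (F - {e})"
    by (intro reachable_in_subsetI)
  moreover have "reachable_in {1..n} (F - {e}) \<subseteq> reachable_in {1..n} F"
    by (intro reachable_in_mono) auto
  ultimately show ?thesis
    using e by blast
qed

text \<open>A subset of \<open>E\<close> with the same reachability and the fewest edges has no
  cycle, since a cycle would allow one more edge to be dropped.\<close>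

lemma spanning_forest_exists:
  assumes "simple_graph n E"
  shows "\<exists>F. spanning_forest n E F"
proof -
  define Q where "Q F \<longleftrightarrow> F \<subseteq> E \<and> reachable_in {1..n} F = reachable_in {1..n} E" for F
  have "Q E"
    by (simp add: Q_def)
  then obtain F where F: "Q F" and min: "\<And>F'. Q F' \<Longrightarrow> card F \<le> card F'"
    using ex_has_least_nat[of Q E card] by blast
  have FE: "F \<subseteq> E" and reach: "reachable_in {1..n} F = reachable_in {1..n} E"
    using F by (auto simp: Q_def)
  have sF: "simple_graph n F"
    using assms FE simple_graph_subset by blast
  have "\<not> is_cycle F p" for p
  proof
    assume "is_cycle F p"
    then obtain e where e: "e \<in> F" "reachable_in {1..n} (F - {e}) = reachable_in {1..n} F"
      using cycle_edge_redundant sF by blast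
    then have "Q (F - {e})"
      using FE reach by (auto simp: Q_def)
    then show False
      using min[of "F - {e}"] e(1) card_Diff1_less[OF simple_graph_finite[OF sF] e(1)] by simp
  qed
  then show ?thesis
    using FE components_cong_reachable[OF reach] by (auto simp: spanning_forest_def)
qed


section \<open>The message encoding\<close>

text \<open>Least significant bit first and without padding: 0 is the empty word, and lengths stay
  logarithmic.\<close>

fun binary :: "nat \<Rightarrow> bool list" where
  "binary k = (if k = 0 then [] else odd k # binary (k div 2))"

declare binary.simps [simp del]

lemma binary_0 [simp]: "binary 0 = []"
  by (simp add: binary.simps)

lemma binary_pos: "k > 0 \<Longrightarrow> binary k = odd k # binary (k div 2)"
  by (simp add: binary.simps)

lemma inj_binary: "inj binary"
proof (rule injI)
  show "binary j = binary k \<Longrightarrow> j = k" for j k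
  proof (induction j arbitrary: k rule: less_induct)
    case (less j)
    show ?case
    proof (cases "j = 0 \<or> k = 0")
      case True
      then show ?thesis
        using less.prems by (metis binary_0 binary_pos list.distinct(1) not_gr_zero)
    next
      case False
      then have "odd j = odd k" "binary (j div 2) = binary (k div 2)"
        using less.prems by (auto simp: binary_pos)
      moreover from this have "j div 2 = k div 2"
        using less.IH[of "j div 2"] False by simp
      moreover from \<open>odd j = odd k\<close> have "j mod 2 = k mod 2"
        by presburger
      ultimately show ?thesis
        by (metis div_mult_mod_eq)
    qed
  qed
qed

lemma length_binary: "k > 0 \<Longrightarrow> 2 ^ length (binary k) \<le> 2 * k"
proof (induction k rule: less_induct)
  case (less k)
  show ?case
  proof (cases "k = 1")
    case True
    then show ?thesis
      by (simp add: binary_pos)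
  next
    case False
    then have "2 ^ length (binary (k div 2)) \<le> 2 * (k div 2)"
      using less by (intro less.IH) auto
    then show ?thesis
      using less.prems by (simp add: binary_pos)
  qed
qed

text \<open>The residue modulo 3 tells the kinds apart: 0 for \<open>Degree\<close>, 2 for
  \<open>Sees_Larger\<close>, and 1 for both \<open>Silent\<close> and \<open>Edge\<close>, where
  codes of \<open>Edge\<close> are at least 7. All codes are positive, as
  \<open>length_binary\<close> requires.\<close>

fun msg_code :: "msg \<Rightarrow> nat" where
  "msg_code Silent = 1"
| "msg_code (Sees_Larger b) = (if b then 2 else 5)"
| "msg_code (Degree d) = 3 * d + 3"
| "msg_code (Edge u v) = 3 * prod_encode (u, v) + 7"

definition enc_msg :: "msg \<Rightarrow> bool list" where
  "enc_msg m = binary (msg_code m)"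

lemma inj_enc_msg: "inj enc_msg"
proof -
  have "msg_code m = msg_code m' \<Longrightarrow> m = m'" for m m'
    by (cases m; cases m') (auto split: if_splits, presburger+)
  then show ?thesis
    using inj_binary by (auto simp: inj_def enc_msg_def)
qed

fun msg_ok :: "nat \<Rightarrow> msg \<Rightarrow> bool" where
  "msg_ok n (Degree d) \<longleftrightarrow> d \<le> n"
| "msg_ok n (Edge u v) \<longleftrightarrow> u \<le> n \<and> v \<le> n"
| "msg_ok n _ \<longleftrightarrow> True"

lemma length_enc_msg:
  assumes "msg_ok n m" "n \<ge> 1"
  shows "real (length (enc_msg m)) \<le> 7 * log 2 (real n + 1)"
proof -
  \<comment> \<open>\<open>prod_encode (u, v)\<close> is \<open>triangle (u + v) + u\<close>, so
    this keeps the code of an edge quadratic in \<open>n\<close>.\<close>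
  have tri: "triangle k \<le> k * k" for k
    by (induction k) auto
  have "msg_code m \<le> 16 * (n + 1)\<^sup>2"
  proof (cases m)
    case (Edge u v)
    have "triangle (u + v) \<le> (u + v) * (u + v)"
      by (rule tri)
    also have "\<dots> \<le> (2 * n) * (2 * n)"
      using assms Edge by (intro mult_mono) auto
    finally have "msg_code m \<le> 3 * (2 * n * (2 * n) + n) + 7"
      using assms Edge by (simp add: prod_encode_def)
    also have "\<dots> \<le> 16 * (n + 1)\<^sup>2"
      by (simp add: power2_eq_square algebra_simps)
    finally show ?thesis .
  qed (use assms in \<open>auto simp: power2_eq_square algebra_simps\<close>)
  moreover have "msg_code m > 0"
    by (cases m) auto
  \<comment> \<open>\<open>length_binary\<close> costs a factor 2, which turns 16 into
    \<open>2 ^ 5\<close>. As \<open>2 \<le> n + 1\<close>, this is absorbed into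
    \<open>(n + 1) ^ 5\<close>; the total exponent 7 is the constant of the bit bound.\<close>
  ultimately have "2 ^ length (enc_msg m) \<le> 2 ^ 5 * (n + 1)\<^sup>2"
    using length_binary[of "msg_code m"] by (simp add: enc_msg_def)
  also have "\<dots> \<le> (n + 1) ^ 5 * (n + 1)\<^sup>2"
    using assms(2) by (intro mult_right_mono power_mono) auto
  also have "\<dots> = (n + 1) ^ 7"
    by (simp flip: power_add)
  finally have "real (2 ^ length (enc_msg m)) \<le> real ((n + 1) ^ 7)"
    by (rule of_nat_mono)
  then have "(2::real) ^ length (enc_msg m) \<le> (real n + 1) ^ 7"
    by (simp add: add.commute)
  then have "log 2 ((2::real) ^ length (enc_msg m)) \<le> log 2 ((real n + 1) ^ 7)"
    by (subst log_le_cancel_iff) auto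
  then show ?thesis
    by (simp add: log_nat_power)
qed

section \<open>The order on components\<close>

lemma comp_degree_attained:
  assumes "finite C" "C \<noteq> {}"
  obtains v where "v \<in> C" "d v = comp_degree d C"
proof -
  have "comp_degree d C \<in> d ` C"
    unfolding comp_degree_def using assms by (intro Max_in) auto
  then show ?thesis
    using that by (metis imageE)
qed

lemma larger_irrefl: "\<not> larger d C C"
  by (simp add: larger_def)

lemma larger_trans: "larger d A B \<Longrightarrow> larger d B C \<Longrightarrow> larger d A C"
  by (auto simp: larger_def)

lemma larger_asym: "larger d A B \<Longrightarrow> \<not> larger d B A"
  using larger_irrefl larger_trans by blast

text \<open>Ties in degree are broken by the smallest node, and disjoint components have different
  smallest nodes.\<close>

lemma larger_total:
  assumes "finite W" "C \<in> components W B" "C' \<in> components W B" "C \<noteq> C'"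
  shows "larger d C C' \<or> larger d C' C"
proof -
  have "Min C \<in> C" "Min C' \<in> C'"
    using assms component_nonempty component_subset finite_subset by (metis Min_in)+
  then have "Min C \<noteq> Min C'"
    using assms components_disjoint by metis
  then show ?thesis
    by (auto simp: larger_def)
qed

lemma largest_exists:
  assumes "finite W" "Q \<subseteq> components W B" "Q \<noteq> {}"
  shows "\<exists>C\<in>Q. \<forall>C'\<in>Q. C' \<noteq> C \<longrightarrow> larger d C C'"
proof -
  have "finite Q"
    using assms finite_components finite_subset by blast
  then show ?thesis
    using assms(3,2)
  proof (induction Q rule: finite_ne_induct)
    case (insert A Q)
    then obtain C where C: "C \<in> Q" "\<And>C'. C' \<in> Q \<Longrightarrow> C' \<noteq> C \<Longrightarrow> larger d C C'"
      by auto
    consider "larger d C A" | "larger d A C"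
      using larger_total[OF assms(1), of C B A d] C(1) insert.prems insert.hyps by blast
    then show ?case
    proof cases
      case 1
      then show ?thesis
        using C by blast
    next
      case 2
      then have "\<forall>C'\<in>Q. larger d A C'"
        using C larger_trans by metis
      then show ?thesis
        by blast
    qed
  qed simp
qed

text \<open>Asymmetry of \<open>larger\<close> makes the maximum unique, so the definite description
  in \<open>largest\<close> denotes it.\<close>

lemma largest:
  assumes "finite W" "Q \<subseteq> components W B" "Q \<noteq> {}"
  shows "largest d Q \<in> Q" "C \<in> Q \<Longrightarrow> C \<noteq> largest d Q \<Longrightarrow> larger d (largest d Q) C"
proof -
  obtain C0 where C0: "C0 \<in> Q" "\<forall>C'\<in>Q. C' \<noteq> C0 \<longrightarrow> larger d C0 C'"
    using largest_exists[OF assms] by blast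
  then have "largest d Q = C0"
    unfolding largest_def by (intro the_equality) (auto dest: larger_asym)
  with C0 show "largest d Q \<in> Q" "C \<in> Q \<Longrightarrow> C \<noteq> largest d Q \<Longrightarrow> larger d (largest d Q) C"
    by auto
qed

section \<open>Neighboring components and their number under merging\<close>

lemma neighbors_sym: "u \<in> neighbors E v \<Longrightarrow> v \<in> neighbors E u"
  by (simp add: neighbors_def insert_commute)

lemma nbr_comps_subset: "nbr_comps P N v \<subseteq> P"
  by (auto simp: nbr_comps_def)

lemma card_nbr_comps_le:
  assumes "finite W"
  shows "card (nbr_comps (components W B) N v) \<le> card W"
  using card_mono[OF finite_components[OF assms] nbr_comps_subset] card_components_le[OF assms]
  by (rule order.trans)

lemma comp_of_nbr_comps:
  assumes "u \<in> W" "u \<in> N" "u \<notin> comp_of (components W B) v"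
  shows "comp_of (components W B) u \<in> nbr_comps (components W B) N v"
  using comp_of_components[OF assms(1), of B] assms by (auto simp: nbr_comps_def)

text \<open>Merging can only lower a degree: every new neighboring component contains an old one, so
  sending an old component to the new one around it reaches all of them.\<close>

lemma card_nbr_comps_antimono:
  assumes "finite W" "v \<in> W" "B \<subseteq> B'"
  shows "card (nbr_comps (components W B') N v) \<le> card (nbr_comps (components W B) N v)"
proof -
  \<comment> \<open>Any node of an old component determines the new component around it, so an
    arbitrary representative serves.\<close>
  let ?f = "\<lambda>C. comp_of (components W B') (SOME x. x \<in> C)"
  have "D \<in> ?f ` nbr_comps (components W B) N v" if "D \<in> nbr_comps (components W B') N v" for D
  proof -
    from that obtain u where D: "D \<in> components W B'" "D \<noteq> comp_of (components W B') v"
      and u: "u \<in> D" "u \<in> N"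
      by (auto simp: nbr_comps_def)
    have uW: "u \<in> W"
      using component_subset D u by blast
    let ?C = "comp_of (components W B) u"
    have "u \<notin> comp_of (components W B') v"
      using D u components_disjoint comp_of_components[OF assms(2)] by metis
    then have "u \<notin> comp_of (components W B) v"
      using comp_of_mono[OF assms(2,3)] by blast
    then have "?C \<in> nbr_comps (components W B) N v"
      using uW u by (intro comp_of_nbr_comps)
    moreover have "?C \<subseteq> D"
      using comp_of_mono[OF uW assms(3)] comp_of_eq[OF D(1) u(1)] by simp
    then have "(SOME x. x \<in> ?C) \<in> D"
      using comp_of_components(2)[OF uW] by (meson someI subsetD)
    then have "?f ?C = D"
      using comp_of_eq D(1) by blast
    ultimately show ?thesis
      by blast
  qed
  then have "nbr_comps (components W B') N v \<subseteq> ?f ` nbr_comps (components W B) N v"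
    by blast
  then show ?thesis
    using finite_subset[OF nbr_comps_subset finite_components[OF assms(1)]]
    by (meson card_image_le card_mono finite_imageI order.trans)
qed


section \<open>One phase\<close>

text \<open>One phase, detached from the transcript. Rounds 2 and 3 have separate choice functions
  because \<open>pick\<close> depends on the view, which has grown in between.\<close>

locale phase =
  fixes n :: nat and E :: "nat set set" and W :: "nat set" and B :: "nat set set"
    and m1 m1' m2 m3 :: "nat \<Rightarrow> msg" and pick2 pick3 :: "nat \<Rightarrow> nat set \<Rightarrow> nat"
  assumes graph: "simple_graph n E" and W: "W \<subseteq> {1..n}"
    and pick2: "\<And>v X. X \<noteq> {} \<Longrightarrow> pick2 v X \<in> X"
    and pick3: "\<And>v X. X \<noteq> {} \<Longrightarrow> pick3 v X \<in> X"
    and m1: "\<And>v. v \<in> W \<Longrightarrow> m1 v = round1_msg (components W B) (neighbors E v) v"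
    and m1': "\<And>v. v \<in> W \<Longrightarrow> m1' v = round1'_msg (components W B) m1 (neighbors E v) v"
    and m2: "\<And>v. v \<in> W \<Longrightarrow>
      m2 v = round2_msg (pick2 v) (components W B) m1 m1' (neighbors E v) v"
    and m3: "\<And>v. v \<in> W \<Longrightarrow>
      m3 v = round3_msg (pick3 v) n (components W B) m1' m2 (neighbors E v) v"
    and silent: "\<And>v. v \<in> {1..n} - W \<Longrightarrow> m2 v = Silent \<and> m3 v = Silent"
begin

abbreviation P :: "nat set set" where "P \<equiv> components W B"

abbreviation nbrs :: "nat \<Rightarrow> nat set set" where "nbrs v \<equiv> nbr_comps P (neighbors E v) v"

abbreviation deg :: "nat \<Rightarrow> nat" where "deg \<equiv> degree_in m1"

abbreviation B' :: "nat set set" where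
  "B' \<equiv> B \<union> broadcast_edges n m2 \<union> broadcast_edges n m3"

lemma finite_W: "finite W"
  using W finite_subset by blast

lemma deg: "v \<in> W \<Longrightarrow> deg v = card (nbrs v)"
  by (simp add: m1 degree_in_def round1_msg_def)

lemma broadcast_edgeI: "m v = Edge u v \<Longrightarrow> v \<in> W \<Longrightarrow> {u, v} \<in> broadcast_edges n m"
  using W by (auto simp: broadcast_edges_def)

lemma largest_nbr:
  assumes "nbrs v \<noteq> {}"
  shows "largest deg (nbrs v) \<in> nbrs v"
    and "C \<in> nbrs v \<Longrightarrow> C = largest deg (nbrs v) \<or> larger deg (largest deg (nbrs v)) C"
  using largest[OF finite_W nbr_comps_subset assms] by auto

lemma m2_edge:
  assumes "v \<in> W" "C \<in> nbrs v" "\<not> is_local_max m1' (comp_of P v)"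
  obtains u where "m2 v = Edge u v" "u \<in> largest deg (nbrs v)" "u \<in> neighbors E v"
proof -
  have ne: "nbrs v \<noteq> {}"
    using assms by blast
  have "largest deg (nbrs v) \<inter> neighbors E v \<noteq> {}"
    using largest_nbr(1)[OF ne] by (auto simp: nbr_comps_def)
  then have "pick2 v (largest deg (nbrs v) \<inter> neighbors E v) \<in> largest deg (nbrs v) \<inter> neighbors E v"
    by (rule pick2)
  then show ?thesis
    using that m2[OF assms(1)] ne assms(3) by (simp add: round2_msg_def)
qed

lemma m3_edge:
  assumes "v \<in> W" "C \<in> lost_comps n P m2 (neighbors E v) v" "is_local_max m1' (comp_of P v)"
  obtains u C' where "m3 v = Edge u v" "C' \<in> lost_comps n P m2 (neighbors E v) v"
    "u \<in> C'" "u \<in> neighbors E v"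
proof -
  let ?X = "\<Union>(lost_comps n P m2 (neighbors E v) v) \<inter> neighbors E v"
  obtain u where "u \<in> C" "u \<in> neighbors E v"
    using assms(2) unfolding lost_comps_def nbr_comps_def by blast
  then have "?X \<noteq> {}"
    using assms(2) by blast
  then have "pick3 v ?X \<in> ?X"
    by (rule pick3)
  moreover have "nbrs v \<noteq> {}"
    using assms(2) by (auto simp: lost_comps_def)
  then have "m3 v = Edge (pick3 v ?X) v"
    using m3[OF assms(1)] assms(2,3) by (auto simp: round3_msg_def)
  ultimately show ?thesis
    using that by blast
qed

lemma m2_EdgeD:
  assumes "m2 v = Edge u w" "v \<in> {1..n}"
  shows "w = v \<and> v \<in> W \<and> u \<in> neighbors E v"
proof -
  have v: "v \<in> W"
    using assms silent by fastforce
  then have *: "nbrs v \<noteq> {}" "\<not> is_local_max m1' (comp_of P v)" "w = v"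
    using m2[OF v] assms(1) by (auto simp: round2_msg_def split: if_splits)
  then obtain C where "C \<in> nbrs v"
    by blast
  then obtain x where "m2 v = Edge x v" "x \<in> neighbors E v"
    using m2_edge[OF v _ *(2)] by metis
  then show ?thesis
    using assms(1) v by simp
qed

lemma m3_EdgeD:
  assumes "m3 v = Edge u w" "v \<in> {1..n}"
  shows "w = v \<and> v \<in> W \<and> u \<in> neighbors E v"
proof -
  have v: "v \<in> W"
    using assms silent by fastforce
  then have *: "lost_comps n P m2 (neighbors E v) v \<noteq> {}" "is_local_max m1' (comp_of P v)" "w = v"
    using m3[OF v] assms(1) by (auto simp: round3_msg_def split: if_splits)
  then obtain C where "C \<in> lost_comps n P m2 (neighbors E v) v"
    by blast
  then show ?thesis
    using m3_edge[OF v _ *(2)] assms(1) v *(3) by (metis msg.inject(3))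
qed

text \<open>Each edge is announced by one of its endpoints, which is active and chooses the other
  end among its own neighbors.\<close>

lemma broadcast_edges_subset: "broadcast_edges n m2 \<union> broadcast_edges n m3 \<subseteq> E"
  unfolding broadcast_edges_def by (auto dest!: m2_EdgeD m3_EdgeD simp: neighbors_def)

lemma sees_larger_iff:
  assumes "C \<in> P" "v \<in> C"
  shows "m1' v = Sees_Larger True \<longleftrightarrow> (\<exists>C'\<in>nbrs v. larger deg C' C)"
proof -
  have "v \<in> W"
    using component_subset assms by blast
  then show ?thesis
    unfolding m1'[OF \<open>v \<in> W\<close>] round1'_msg_def comp_of_eq[OF assms] by simp
qed

text \<open>A broadcast edge with one end in \<open>D\<close> has its other active end in
  \<open>D\<close> as well. So an edge from \<open>D\<close> to an old component above
  \<open>C\<close> would put that component into \<open>Q\<close>, against the choice of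
  \<open>C\<close>; both contradictions below have this form.\<close>

lemma surviving_component_has_many_parts:
  assumes D: "D \<in> components W B'" and v: "v \<in> D"
    and s: "s \<le> card (nbr_comps (components W B') (neighbors E v) v)"
  shows "\<exists>Q\<subseteq>P. s + 1 \<le> card Q \<and> \<Union>Q \<subseteq> D"
proof -
  define Q where "Q = {C \<in> P. C \<subseteq> D}"
  have B': "B \<subseteq> B'"
    by blast
  have DW: "D \<subseteq> W"
    using D component_subset by blast
  have comp_Q: "comp_of P x \<in> Q" if "x \<in> D" for x
    using comp_of_components(1)[of x W B] comp_of_mono[OF _ B', of x W] comp_of_eq[OF D that] DW that
    unfolding Q_def by auto
  have mem_Q: "C \<in> Q" if "C \<in> P" "x \<in> C" "x \<in> D" for C x
    using comp_Q[OF that(3)] comp_of_eq[OF that(1,2)] by simp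
  have edge_D: "y \<in> D"
    if "{x, y} \<in> broadcast_edges n m2 \<union> broadcast_edges n m3" "x \<in> D" "y \<in> W" for x y
  proof -
    have "x \<in> W"
      using DW that(2) by blast
    then have "(x, y) \<in> reachable_in W B'"
      using that by (intro reachable_in_edge) auto
    then show ?thesis
      using component_mem_iff[OF D that(2)] that(3) by simp
  qed
  have fin: "finite Q" "Q \<subseteq> P"
    using finite_components[OF finite_W] by (auto simp: Q_def)
  have "Q \<noteq> {}"
    using comp_Q[OF v] by blast
  then obtain C where C: "C \<in> Q" and C_max: "\<And>C'. C' \<in> Q \<Longrightarrow> C' \<noteq> C \<Longrightarrow> larger deg C C'"
    using largest_exists[OF finite_W fin(2), of deg] by blast
  have CP: "C \<in> P" and CD: "C \<subseteq> D"
    using C by (auto simp: Q_def)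
  have not_larger: "\<not> larger deg C' C" if "C' \<in> Q" for C'
    using C_max[OF that] larger_asym larger_irrefl by metis
  \<comment> \<open>A node \<open>x\<close> of \<open>C\<close> that sees something larger
    broadcasts in Round 2 towards its largest neighboring component, which then joins
    \<open>D\<close> although it exceeds \<open>C\<close>.\<close>
  have local_max: "is_local_max m1' C"
    unfolding is_local_max_def
  proof (intro ballI notI)
    fix x
    assume x: "x \<in> C" "m1' x = Sees_Larger True"
    then obtain C' where C': "C' \<in> nbrs x" "larger deg C' C"
      using sees_larger_iff[OF CP] by blast
    have xW: "x \<in> W" and cx: "comp_of P x = C"
      using x CD DW comp_of_eq[OF CP] by auto
    let ?L = "largest deg (nbrs x)"
    obtain y where y: "m2 x = Edge y x" "y \<in> ?L"
      using m2_edge[OF xW C'(1)] x cx by (auto simp: is_local_max_def)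
    have L: "?L \<in> P" "larger deg ?L C"
      using largest_nbr[of x] C' nbr_comps_subset larger_trans by blast+
    have "y \<in> W"
      using L(1) y(2) component_subset by blast
    then have "y \<in> D"
      using edge_D[of x y] broadcast_edgeI[of m2, OF y(1) xW] x(1) CD by (auto simp: insert_commute)
    then have "?L \<in> Q"
      using mem_Q L(1) y(2) by blast
    then show False
      using not_larger L(2) by blast
  qed
  \<comment> \<open>A neighbor \<open>x\<close> across the border sees \<open>C\<close> above its
    own component, so it must broadcast in Round 2, and its target is \<open>C\<close> or something
    larger. Whether \<open>x\<close> belongs to \<open>D\<close> is still open here.\<close>
  have nbr_edge: "\<exists>y L. {y, x} \<in> broadcast_edges n m2 \<and> y \<in> L \<and> L \<in> P \<and> (L = C \<or> larger deg L C)"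
    if x: "x \<in> C'" "C' \<in> nbrs w" "x \<in> neighbors E w" and w: "w \<in> C" for w x C'
  proof -
    have C': "C' \<in> P" "C' \<noteq> C"
      using x(2) comp_of_eq[OF CP w] by (auto simp: nbr_comps_def)
    have xW: "x \<in> W" and cx: "comp_of P x = C'"
      using C' x(1) component_subset comp_of_eq by auto
    have "\<not> larger deg C' C"
      using local_max w sees_larger_iff[OF CP w] x(2) unfolding is_local_max_def by blast
    then have "larger deg C C'"
      using larger_total[OF finite_W CP C'(1)] C'(2) by blast
    moreover have Cx: "C \<in> nbrs x"
      using CP C'(2) cx w neighbors_sym[OF x(3)] by (auto simp: nbr_comps_def)
    ultimately have "\<not> is_local_max m1' C'"
      using sees_larger_iff[OF C'(1) x(1)] x(1) unfolding is_local_max_def by blast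
    then obtain y where y: "m2 x = Edge y x" "y \<in> largest deg (nbrs x)"
      using m2_edge[OF xW Cx] cx by auto
    have "largest deg (nbrs x) \<in> P"
      "largest deg (nbrs x) = C \<or> larger deg (largest deg (nbrs x)) C"
      using largest_nbr[of x] Cx nbr_comps_subset by blast+
    then show ?thesis
      using y broadcast_edgeI[of m2, OF y(1) xW] by blast
  qed
  have all_nbrs: "C' \<in> Q" if w: "w \<in> C" and C': "C' \<in> nbrs w" for w C'
  proof -
    have wW: "w \<in> W" and wD: "w \<in> D" and cw: "comp_of P w = C"
      using w CD DW comp_of_eq[OF CP] by auto
    \<comment> \<open>Otherwise \<open>w\<close> attaches a lost component in Round 3 through a node
      \<open>x\<close>. The Round 2 edge of \<open>x\<close> goes to some \<open>L\<close>, and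
      \<open>L\<close> is not \<open>C\<close> because the component was lost; so \<open>L\<close>
      exceeds \<open>C\<close> and is pulled into \<open>D\<close>.\<close>
    have "lost_comps n P m2 (neighbors E w) w = {}"
    proof (rule ccontr)
      assume "lost_comps n P m2 (neighbors E w) w \<noteq> {}"
      then obtain C0 where "C0 \<in> lost_comps n P m2 (neighbors E w) w"
        by blast
      then obtain x C1 where x: "m3 w = Edge x w" "x \<in> C1" "x \<in> neighbors E w"
        and C1: "C1 \<in> lost_comps n P m2 (neighbors E w) w"
        using m3_edge[OF wW] local_max cw by metis
      have C1n: "C1 \<in> nbrs w"
        and lost: "\<And>a b. a \<in> C1 \<Longrightarrow> b \<in> C \<Longrightarrow> {a, b} \<notin> broadcast_edges n m2"
        using C1 cw by (auto simp: lost_comps_def)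
      obtain y L where yL: "{y, x} \<in> broadcast_edges n m2" "y \<in> L" "L \<in> P" "L = C \<or> larger deg L C"
        using nbr_edge[OF x(2) C1n x(3) w] by blast
      have "L \<noteq> C"
        using lost[OF x(2), of y] yL(1,2) by (auto simp: insert_commute)
      have "x \<in> W" "y \<in> W"
        using C1n x(2) yL(2,3) component_subset by (auto simp: nbr_comps_def)
      then have "x \<in> D"
        using edge_D[of w x] broadcast_edgeI[of m3, OF x(1) wW] wD by (auto simp: insert_commute)
      then have "y \<in> D"
        using edge_D[of x y] yL(1) \<open>y \<in> W\<close> by (auto simp: insert_commute)
      then show False
        using mem_Q[OF yL(3,2)] not_larger yL(4) \<open>L \<noteq> C\<close> by blast
    qed
    then have "C' \<notin> lost_comps n P m2 (neighbors E w) w"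
      by blast
    then obtain a b where ab: "a \<in> C'" "b \<in> C" "{a, b} \<in> broadcast_edges n m2"
      using C' cw by (auto simp: lost_comps_def)
    have C'P: "C' \<in> P"
      using C' nbr_comps_subset by blast
    then have "a \<in> W"
      using component_subset ab(1) by blast
    then have "a \<in> D"
      using edge_D[of b a] ab(2,3) CD by (auto simp: insert_commute)
    then show ?thesis
      using mem_Q C'P ab(1) by blast
  qed
  have ne_C: "C \<noteq> {}"
    using component_nonempty[OF CP] .
  have fin_C: "finite C" "finite (comp_of P v)"
    using finite_component[OF finite_W] CP comp_Q[OF v] fin(2) by blast+
  obtain w where w: "w \<in> C" "deg w = comp_degree deg C"
    using comp_degree_attained[OF fin_C(1) ne_C] .
  have vW: "v \<in> W"
    using v DW by blast
  \<comment> \<open>The degree passes from the new partition to the old one, from \<open>v\<close>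
    to its old component, then to the maximum \<open>C\<close> and its node \<open>w\<close> of top
    degree. All neighboring components of \<open>w\<close> lie in \<open>Q - {C}\<close>; counting
    \<open>C\<close> too gives the \<open>+ 1\<close>.\<close>
  have "s \<le> card (nbrs v)"
    using s card_nbr_comps_antimono[OF finite_W vW B'] by (rule order.trans)
  also have "\<dots> = deg v"
    using deg[OF vW] by simp
  also have "\<dots> \<le> comp_degree deg (comp_of P v)"
    unfolding comp_degree_def using fin_C comp_of_components(2)[OF vW] by (intro Max_ge) auto
  also have "\<dots> \<le> comp_degree deg C"
    using C_max[OF comp_Q[OF v]] unfolding larger_def by (cases "comp_of P v = C") auto
  also have "\<dots> = card (nbrs w)"
    using w deg CD DW by auto
  also have "\<dots> \<le> card (Q - {C})"
    using all_nbrs[OF w(1)] fin comp_of_eq[OF CP w(1)]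
    by (intro card_mono) (auto simp: nbr_comps_def)
  finally have "s + 1 \<le> card Q"
    using card_Suc_Diff1[OF fin(1) C] by simp
  then show ?thesis
    using fin by (intro exI[of _ Q]) (auto simp: Q_def)
qed

text \<open>The old parts are disjoint, so their sizes add up. This yields the growth factor
  \<open>s + 1\<close> per phase.\<close>

lemma surviving_component_size:
  assumes D: "D \<in> components W B'" and v: "v \<in> D"
    and s: "s \<le> card (nbr_comps (components W B') (neighbors E v) v)"
    and k: "\<And>C. C \<in> P \<Longrightarrow> k \<le> card C"
  shows "(s + 1) * k \<le> card D"
proof -
  obtain Q where Q: "Q \<subseteq> P" "s + 1 \<le> card Q" "\<Union>Q \<subseteq> D"
    using surviving_component_has_many_parts[OF D v s] by blast
  have fin: "finite D" "\<And>C. C \<in> P \<Longrightarrow> finite C"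
    using finite_component[OF finite_W] D by blast+
  have "(s + 1) * k \<le> card Q * k"
    by (rule mult_le_mono1[OF Q(2)])
  also have "\<dots> \<le> (\<Sum>C\<in>Q. card C)"
    using k Q(1) sum_bounded_below[of Q k card] by auto
  also have "\<dots> = card (\<Union>Q)"
  proof (rule card_Union_disjoint[symmetric])
    show "pairwise disjnt Q"
      unfolding pairwise_def disjnt_def using Q(1) components_disjoint by blast
  qed (use Q(1) fin(2) in blast)
  also have "\<dots> \<le> card D"
    using Q(3) fin(1) by (intro card_mono)
  finally show ?thesis .
qed

end

section \<open>The whole run\<close>

lemma Union_components [simp]: "\<Union>(components W B) = W"
  using component_subset comp_of_components by blast

lemma locate_short: "length H < 5 \<Longrightarrow> locate s n S H = (S, H)"
  by (cases "(s, n, S, H)" rule: locate.cases) auto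

lemma locate_done: "active S = {} \<Longrightarrow> locate s n S H = (S, H)"
  by (cases "(s, n, S, H)" rule: locate.cases) auto

locale run =
  fixes s n :: nat and E :: "nat set set" and pick :: pick_rule
  assumes graph: "simple_graph n E" and n: "n \<ge> 1"
    and pick: "\<And>V X. X \<noteq> {} \<Longrightarrow> pick V X \<in> X"
begin

abbreviation tr :: "nat \<Rightarrow> (nat \<Rightarrow> msg) list" where
  "tr \<equiv> transcript (broadcast_cc s pick) n E"

definition M :: "nat \<Rightarrow> nat \<Rightarrow> msg" where
  "M i = (\<lambda>v\<in>{1..n}. message (broadcast_cc s pick) (view_of n E (tr i) v))"

lemma tr: "tr i = map M [0..<i]"
proof (induction i)
  case (Suc i)
  have "tr (Suc i) = tr i @ [M i]"
    by (simp only: transcript.simps M_def)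
  then show ?case
    using Suc by simp
qed simp

text \<open>Five rounds make a phase, and its last three determine the next state. The recursion
  runs on after the last active node is gone, where it need not be what \<open>locate\<close> reads;
  hence the guard \<open>alive\<close> below.\<close>

primrec st :: "nat \<Rightarrow> state" where
  "st 0 = initial_state n"
| "st (Suc q) = next_state s n (st q) (M (5 * q + 2)) (M (5 * q + 3)) (M (5 * q + 4))"

lemma upt_five: "[a..<a + (5 + t)] = [a, a + 1, a + 2, a + 3, a + 4] @ [a + 5..<a + 5 + t]"
  by (simp add: upt_conv_Cons numeral_eq_Suc)

lemma upt_small:
  "[a..<a + 2] = [a, a + 1]" "[a..<a + 3] = [a, a + 1, a + 2]"
  "[a..<a + 4] = [a, a + 1, a + 2, a + 3]"
  by (simp_all add: upt_conv_Cons numeral_eq_Suc)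

text \<open>The remainder \<open>t\<close> is arbitrary because the induction moves one phase, that
  is five rounds, from the remainder to the counter.\<close>

lemma locate_tr:
  "\<forall>q<J. active (st q) \<noteq> {} \<Longrightarrow>
    locate s n (initial_state n) (tr (5 * J + t)) = locate s n (st J) (map M [5 * J..<5 * J + t])"
proof (induction J arbitrary: t)
  case (Suc J)
  have J: "5 * Suc J = 5 * J + 5"
    by simp
  show ?case
    using Suc.IH[of "5 + t"] Suc.prems unfolding J upt_five by (simp add: add.assoc)
qed (simp add: tr)

text \<open>\<open>alive (Suc q)\<close> expresses that phase \<open>q\<close> is really carried
  out; \<open>alive J\<close> together with no active node in \<open>st J\<close> marks the start of
  the Playoff.\<close>

definition alive :: "nat \<Rightarrow> bool" where
  "alive J \<longleftrightarrow> (\<forall>q<J. active (st q) \<noteq> {})"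

lemma locate_phase:
  assumes "alive (Suc q)" "t < 5"
  shows "locate s n (initial_state n) (tr (5 * q + t)) = (st q, map M [5 * q..<5 * q + t])"
  using locate_tr[of q t] assms by (simp add: locate_short alive_def)

lemma locate_playoff:
  assumes "alive J" "active (st J) = {}"
  shows "locate s n (initial_state n) (tr (5 * J + t)) = (st J, map M [5 * J..<5 * J + t])"
  using locate_tr[of J t] assms by (simp add: locate_done alive_def)

lemma M_eq:
  assumes "v \<in> {1..n}" "locate s n (initial_state n) (tr i) = (S, H)"
  shows "M i v =
    (if active S = {} then playoff_msg (pick (view_of n E (tr i) v)) S H (neighbors E v) v
     else if v \<notin> active S then Silent
     else case H of
         [] \<Rightarrow> round1_msg (current_part S) (neighbors E v) v
       | [m1] \<Rightarrow> round1'_msg (current_part S) m1 (neighbors E v) v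
       | [m1, m1'] \<Rightarrow>
           round2_msg (pick (view_of n E (tr i) v)) (current_part S) m1 m1' (neighbors E v) v
       | [m1, m1', m2] \<Rightarrow>
           round3_msg (pick (view_of n E (tr i) v)) n (current_part S) m1' m2 (neighbors E v) v
       | [m1, m1', m2, m3] \<Rightarrow> round1_msg (merged_part n S m2 m3) (neighbors E v) v
       | _ \<Rightarrow> Silent)"
proof -
  have "M i v = broadcast_cc_message s pick (view_of n E (tr i) v)"
    using assms(1) by (simp add: M_def broadcast_cc_def)
  then show ?thesis
    using assms(2) unfolding broadcast_cc_message_def by (simp add: view_of_def Let_def)
qed

lemma M_phase:
  assumes "alive (Suc q)" "v \<in> {1..n}"
  shows "v \<in> active (st q) \<Longrightarrow>
      M (5 * q) v = round1_msg (current_part (st q)) (neighbors E v) v"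
    and "v \<in> active (st q) \<Longrightarrow>
      M (5 * q + 1) v = round1'_msg (current_part (st q)) (M (5 * q)) (neighbors E v) v"
    and "v \<in> active (st q) \<Longrightarrow>
      M (5 * q + 2) v = round2_msg (pick (view_of n E (tr (5 * q + 2)) v)) (current_part (st q))
        (M (5 * q)) (M (5 * q + 1)) (neighbors E v) v"
    and "v \<in> active (st q) \<Longrightarrow>
      M (5 * q + 3) v = round3_msg (pick (view_of n E (tr (5 * q + 3)) v)) n (current_part (st q))
        (M (5 * q + 1)) (M (5 * q + 2)) (neighbors E v) v"
    and "v \<in> active (st q) \<Longrightarrow>
      M (5 * q + 4) v = round1_msg (merged_part n (st q) (M (5 * q + 2)) (M (5 * q + 3)))
        (neighbors E v) v"
    and "v \<notin> active (st q) \<Longrightarrow> t < 5 \<Longrightarrow> M (5 * q + t) v = Silent"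
proof -
  have *: "active (st q) \<noteq> {}"
    using assms(1) by (simp add: alive_def)
  note M_eq = M_eq[OF assms(2) locate_phase[OF assms(1)]]
  show "v \<in> active (st q) \<Longrightarrow>
      M (5 * q) v = round1_msg (current_part (st q)) (neighbors E v) v"
    using M_eq[of 0] * by simp
  show "v \<in> active (st q) \<Longrightarrow>
      M (5 * q + 1) v = round1'_msg (current_part (st q)) (M (5 * q)) (neighbors E v) v"
    using M_eq[of 1] * by simp
  show "v \<in> active (st q) \<Longrightarrow>
      M (5 * q + 2) v = round2_msg (pick (view_of n E (tr (5 * q + 2)) v)) (current_part (st q))
        (M (5 * q)) (M (5 * q + 1)) (neighbors E v) v"
    using M_eq[of 2] * unfolding upt_small by simp
  show "v \<in> active (st q) \<Longrightarrow>
      M (5 * q + 3) v = round3_msg (pick (view_of n E (tr (5 * q + 3)) v)) n (current_part (st q))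
        (M (5 * q + 1)) (M (5 * q + 2)) (neighbors E v) v"
    using M_eq[of 3] * unfolding upt_small by simp
  show "v \<in> active (st q) \<Longrightarrow>
      M (5 * q + 4) v = round1_msg (merged_part n (st q) (M (5 * q + 2)) (M (5 * q + 3)))
        (neighbors E v) v"
    using M_eq[of 4] * unfolding upt_small by simp
  show "v \<notin> active (st q) \<Longrightarrow> t < 5 \<Longrightarrow> M (5 * q + t) v = Silent"
    using M_eq[of t] * by simp
qed

section \<open>The invariant over the phases\<close>

lemma phase:
  assumes "alive (Suc q)" "active (st q) \<subseteq> {1..n}"
  shows "phase n E (active (st q)) (known (st q))
    (M (5 * q)) (M (5 * q + 1)) (M (5 * q + 2)) (M (5 * q + 3))
    (\<lambda>v. pick (view_of n E (tr (5 * q + 2)) v)) (\<lambda>v. pick (view_of n E (tr (5 * q + 3)) v))"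
proof -
  have v: "v \<in> {1..n}" if "v \<in> active (st q)" for v
    using that assms(2) by blast
  note M = M_phase(1-4)[OF assms(1) v, unfolded current_part_def]
  have silent: "M (5 * q + 2) v = Silent \<and> M (5 * q + 3) v = Silent"
    if "v \<in> {1..n} - active (st q)" for v
    using that M_phase(6)[OF assms(1), of v 2] M_phase(6)[OF assms(1), of v 3] by simp
  show ?thesis
    by unfold_locales (simp_all only: graph assms(2) M silent pick not_False_eq_True)
qed

text \<open>\<open>W\<close> stands for the nodes active in the last phase of \<open>v\<close>, and
  \<open>B\<close> for the edges known at its end. The inclusions make the condition stable under
  later phases, and the bound by \<open>s\<close> lets the Playoff finish in time.\<close>

definition exit_ok :: "state \<Rightarrow> nat \<Rightarrow> bool" where
  "exit_ok S v \<longleftrightarrow> (\<exists>W B. exit_part S v = components W B \<and> v \<in> W \<and> active S \<subseteq> W \<and> W \<subseteq> {1..n} \<and>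
     B \<subseteq> known S \<and> card (nbr_comps (exit_part S v) (neighbors E v) v) < s)"

text \<open>The last conjunct says that of two deactivated nodes, the one deactivated first has the other
  in its exit partition, so every edge of the input graph is seen by one of its endpoints in the
  Playoff.\<close>

definition invar :: "nat \<Rightarrow> state \<Rightarrow> bool" where
  "invar k S \<longleftrightarrow> active S \<subseteq> {1..n} \<and> known S \<subseteq> E \<and> (\<forall>C\<in>current_part S. k \<le> card C) \<and>
     (\<forall>v\<in>{1..n} - active S. exit_ok S v) \<and>
     (\<forall>u\<in>{1..n} - active S. \<forall>v\<in>{1..n} - active S.
        u \<in> \<Union>(exit_part S v) \<or> v \<in> \<Union>(exit_part S u))"

lemma invar_initial: "invar 1 (initial_state n)"
proof -
  have "1 \<le> card C" if "C \<in> components {1..n} {}" for C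
    using finite_component[OF _ that] component_nonempty[OF that]
    by (simp add: Suc_le_eq card_gt_0_iff)
  then show ?thesis
    by (simp add: invar_def initial_state_def current_part_def)
qed

lemma invar_step:
  assumes alive: "alive (Suc q)" and inv: "invar k (st q)"
  shows "invar ((s + 1) * k) (st (Suc q))"
proof -
  define W where "W = active (st q)"
  have W: "W \<subseteq> {1..n}"
    using inv by (simp add: invar_def W_def)
  then have finW: "finite W"
    using finite_subset by blast
  interpret phase n E W "known (st q)" "M (5 * q)" "M (5 * q + 1)" "M (5 * q + 2)" "M (5 * q + 3)"
    "\<lambda>v. pick (view_of n E (tr (5 * q + 2)) v)" "\<lambda>v. pick (view_of n E (tr (5 * q + 3)) v)"
    using phase[OF alive] W by (simp add: W_def)
  define P' where "P' = components W B'"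
  define d where "d = degree_in (M (5 * q + 4))"
  define D where "D = {v \<in> W. comp_degree d (comp_of P' v) < s}"
  have P': "merged_part n (st q) (M (5 * q + 2)) (M (5 * q + 3)) = P'"
    by (simp add: merged_part_def P'_def W_def)
  have st: "active (st (Suc q)) = W - D" "known (st (Suc q)) = B'"
    "exit_part (st (Suc q)) = (\<lambda>v. if v \<in> D then P' else exit_part (st q) v)"
    unfolding st.simps next_state_def Let_def P' W_def D_def d_def by simp_all
  have d: "d v = card (nbr_comps P' (neighbors E v) v)" if "v \<in> W" for v
  proof -
    have "M (5 * q + 4) v = round1_msg P' (neighbors E v) v"
      using M_phase(5)[OF alive] that W unfolding P' W_def by blast
    then show ?thesis
      by (simp add: d_def degree_in_def round1_msg_def)
  qed
  have d_le: "d v \<le> comp_degree d C" if "C \<in> P'" "v \<in> C" for C v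
    using that finite_component[OF finW] unfolding P'_def comp_degree_def
    by (intro Max_ge) auto
  have D_iff: "v \<in> D \<longleftrightarrow> comp_degree d C < s" if "C \<in> P'" "v \<in> C" for C v
    using that comp_of_eq component_subset unfolding D_def P'_def by blast
  have size: "(s + 1) * k \<le> card C" if C: "C \<in> components (W - D) B'" for C
  proof -
    \<comment> \<open>Deactivation depends on the degree of the whole component, so
      \<open>W - D\<close> is a union of merged components and the survivors remain intact.\<close>
    have "components (W - D) B' \<subseteq> components W B'"
    proof (rule components_restrict)
      fix C
      assume "C \<in> components W B'" "C \<inter> (W - D) \<noteq> {}"
      then show "C \<subseteq> W - D"
        using D_iff[of C] component_subset[of C W B'] by (auto simp: P'_def)
    qed blast
    then have C': "C \<in> components W B'"
      using C by blast
    have CWD: "C \<subseteq> W - D"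
      using component_subset[OF C] .
    \<comment> \<open>A node of maximal degree shows that the surviving component still sees at
      least \<open>s\<close> others.\<close>
    obtain v where v: "v \<in> C" "d v = comp_degree d C"
      using comp_degree_attained[OF finite_component[OF finW C'] component_nonempty[OF C]] .
    then have "s \<le> d v"
      using D_iff[of C v] C' CWD by (auto simp: P'_def)
    then have "s \<le> card (nbr_comps (components W B') (neighbors E v) v)"
      using d[of v] v(1) CWD by (auto simp: P'_def)
    moreover have "k \<le> card C" if "C \<in> components W (known (st q))" for C
      using that inv by (simp add: invar_def current_part_def W_def)
    ultimately show ?thesis
      by (intro surviving_component_size[OF C' v(1)])
  qed
  \<comment> \<open>A node leaving now has \<open>W\<close> and \<open>B'\<close> as witnesses; one
    that left earlier keeps its own.\<close>
  have exit: "exit_ok (st (Suc q)) v" if v: "v \<in> {1..n} - (W - D)" for v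
  proof (cases "v \<in> D")
    case True
    then have vW: "v \<in> W"
      by (simp add: D_def)
    have "d v \<le> comp_degree d (comp_of P' v)"
      using comp_of_components[OF vW] by (intro d_le) (simp_all add: P'_def)
    then have "card (nbr_comps P' (neighbors E v) v) < s"
      using True d[OF vW] by (simp add: D_def)
    then show ?thesis
      using True vW W unfolding exit_ok_def st by (intro exI[of _ W] exI[of _ B']) (auto simp: P'_def)
  next
    case False
    then have "exit_ok (st q) v"
      using v inv by (auto simp: invar_def W_def)
    then obtain W0 B0 where "exit_part (st q) v = components W0 B0" "v \<in> W0" "W \<subseteq> W0"
      "W0 \<subseteq> {1..n}" "B0 \<subseteq> known (st q)"
      "card (nbr_comps (exit_part (st q) v) (neighbors E v) v) < s"
      unfolding exit_ok_def W_def by blast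
    then show ?thesis
      using False unfolding exit_ok_def st by (intro exI[of _ W0] exI[of _ B0]) auto
  qed
  have order: "u \<in> \<Union>(exit_part (st (Suc q)) v) \<or> v \<in> \<Union>(exit_part (st (Suc q)) u)"
    if u: "u \<in> {1..n} - (W - D)" and v: "v \<in> {1..n} - (W - D)" for u v
  proof -
    \<comment> \<open>A node gone before this phase has everything active now in its exit partition;
      two nodes leaving together share \<open>P'\<close>, which covers both.\<close>
    have old: "W \<subseteq> \<Union>(exit_part (st q) x)" if "x \<in> {1..n} - W" for x
    proof -
      have "exit_ok (st q) x"
        using inv that unfolding invar_def W_def by blast
      then show ?thesis
        unfolding exit_ok_def W_def by (metis Union_components)
    qed
    have UP': "\<Union>P' = W" and DW: "D \<subseteq> W"
      by (auto simp: P'_def D_def)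
    show ?thesis
    proof (cases "u \<in> D \<or> v \<in> D")
      case True
      then show ?thesis
        unfolding st using u v old[of u] old[of v] UP' DW
        by (cases "u \<in> D"; cases "v \<in> D") (simp_all, blast+)
    next
      case False
      then have "u \<in> {1..n} - W" "v \<in> {1..n} - W"
        using u v by blast+
      then have "u \<in> \<Union>(exit_part (st q) v) \<or> v \<in> \<Union>(exit_part (st q) u)"
        using inv unfolding invar_def W_def by blast
      then show ?thesis
        using False unfolding st by simp
    qed
  qed
  have "B' \<subseteq> E"
    using broadcast_edges_subset inv by (auto simp: invar_def)
  then show ?thesis
    using W size exit order unfolding invar_def current_part_def st by blast
qed

lemma invar: "alive J \<Longrightarrow> invar ((s + 1) ^ J) (st J)"
proof (induction J)
  case 0
  then show ?case
    using invar_initial by simp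
next
  case (Suc J)
  then have "invar ((s + 1) ^ J) (st J)"
    by (simp add: alive_def)
  then show ?case
    using invar_step[OF Suc.prems] by simp
qed

lemma active_bound:
  assumes "alive J" "active (st J) \<noteq> {}"
  shows "(s + 1) ^ J \<le> n"
proof -
  have inv: "invar ((s + 1) ^ J) (st J)"
    using invar[OF assms(1)] .
  obtain v where "v \<in> active (st J)"
    using assms(2) by blast
  then have C: "comp_of (current_part (st J)) v \<in> current_part (st J)" (is "?C \<in> _")
    using comp_of_components by (simp add: current_part_def)
  then have "(s + 1) ^ J \<le> card ?C"
    using inv by (simp add: invar_def)
  also have "?C \<subseteq> {1..n}"
    using C inv component_subset unfolding invar_def current_part_def by blast
  then have "card ?C \<le> n"
    using card_mono[of "{1..n}" ?C] by simp
  finally show ?thesis .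
qed

lemma eventually_inactive:
  assumes "s \<ge> 1"
  shows "\<exists>J. alive J \<and> active (st J) = {}"
proof (rule ccontr)
  assume *: "\<not> ?thesis"
  have "alive J" for J
    by (induction J) (use * in \<open>auto simp: alive_def less_Suc_eq\<close>)
  \<comment> \<open>At \<open>J = n\<close> the size bound fails, since already \<open>2 ^ n\<close>
    exceeds \<open>n\<close>.\<close>
  then have "(s + 1) ^ n \<le> n"
    using active_bound * by blast
  moreover have "n < 2 ^ n"
    by simp
  moreover have "(2::nat) ^ n \<le> (s + 1) ^ n"
    using assms by (intro power_mono) auto
  ultimately show False
    by linarith
qed

section \<open>Size of the numbers broadcast in a phase\<close>

lemma msg_ok_round1:
  assumes "W \<subseteq> {1..n}"
  shows "msg_ok n (round1_msg (components W B) N v)"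
proof -
  have "card (nbr_comps (components W B) N v) \<le> card W"
    using assms finite_subset by (intro card_nbr_comps_le) blast
  also have "\<dots> \<le> n"
    using card_mono[OF _ assms] by simp
  finally show ?thesis
    by (simp add: round1_msg_def)
qed

lemma msg_ok_phase:
  assumes alive: "alive (Suc q)" and v: "v \<in> {1..n}" and t: "t < 5"
  shows "msg_ok n (M (5 * q + t) v)"
proof (cases "v \<in> active (st q)")
  case False
  then show ?thesis
    using M_phase(6)[OF alive v _ t] by simp
next
  case True
  have W: "active (st q) \<subseteq> {1..n}"
    using invar[of q] alive by (simp add: alive_def invar_def)
  interpret phase n E "active (st q)" "known (st q)"
    "M (5 * q)" "M (5 * q + 1)" "M (5 * q + 2)" "M (5 * q + 3)"
    "\<lambda>v. pick (view_of n E (tr (5 * q + 2)) v)" "\<lambda>v. pick (view_of n E (tr (5 * q + 3)) v)"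
    using phase[OF alive W] .
  have nb: "u \<le> n" if "u \<in> neighbors E v" for u
    using that simple_graph_edge(1)[OF graph, of u v] by (simp add: neighbors_def)
  note M = M_phase[OF alive v]
  consider "t = 0" | "t = 1" | "t = 2" | "t = 3" | "t = 4"
    using t by linarith
  then show ?thesis
  proof cases
    case 1
    then show ?thesis
      using M(1)[OF True] msg_ok_round1[OF W] by (simp add: current_part_def)
  next
    case 2
    then show ?thesis
      using M(2)[OF True] by (simp add: round1'_msg_def)
  next
    case 3
    have "msg_ok n (M (5 * q + 2) v)"
    proof (cases "M (5 * q + 2) v")
      case (Degree d)
      then show ?thesis
        using M(3)[OF True] by (simp add: round2_msg_def split: if_splits)
    next
      case (Edge u w)
      then show ?thesis
        using m2_EdgeD[OF _ v] nb v by auto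
    qed simp_all
    then show ?thesis
      using 3 by simp
  next
    case 4
    have "msg_ok n (M (5 * q + 3) v)"
    proof (cases "M (5 * q + 3) v")
      case (Degree d)
      then show ?thesis
        using M(4)[OF True] by (simp add: round3_msg_def split: if_splits)
    next
      case (Edge u w)
      then show ?thesis
        using m3_EdgeD[OF _ v] nb v by auto
    qed simp_all
    then show ?thesis
      using 4 by simp
  next
    case 5
    then show ?thesis
      using M(5)[OF True] msg_ok_round1[OF W] by (simp add: merged_part_def)
  qed
qed

end

section \<open>The Playoff\<close>

locale playoff = run +
  fixes J :: nat
  assumes alive: "alive J" and inactive: "active (st J) = {}"
begin

abbreviation S :: state where "S \<equiv> st J"

abbreviation H :: "nat \<Rightarrow> (nat \<Rightarrow> msg) list" where "H t \<equiv> map M [5 * J..<5 * J + t]"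

abbreviation uncovered :: "nat \<Rightarrow> nat \<Rightarrow> nat set set" where
  "uncovered t v \<equiv> uncovered_comps S (H t) (neighbors E v) v"

lemma M_playoff_Silent: "v \<in> {1..n} \<Longrightarrow> uncovered t v = {} \<Longrightarrow> M (5 * J + t) v = Silent"
  using M_eq[OF _ locate_playoff[OF alive inactive]] inactive by (simp add: playoff_msg_def)

lemma M_playoff_Edge:
  assumes "v \<in> {1..n}" "uncovered t v \<noteq> {}"
  shows "\<exists>u C. M (5 * J + t) v = Edge u v \<and> C \<in> uncovered t v \<and> u \<in> C \<and> u \<in> neighbors E v"
proof -
  let ?V = "view_of n E (tr (5 * J + t)) v"
  let ?X = "\<Union>(uncovered t v) \<inter> neighbors E v"
  obtain C where "C \<in> uncovered t v"
    using assms(2) by blast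
  then have "?X \<noteq> {}"
    unfolding uncovered_comps_def nbr_comps_def by blast
  then have "pick ?V ?X \<in> ?X"
    by (rule pick)
  moreover have "M (5 * J + t) v = Edge (pick ?V ?X) v"
    using M_eq[OF assms(1) locate_playoff[OF alive inactive]] inactive assms(2)
    by (simp add: playoff_msg_def)
  ultimately show ?thesis
    by blast
qed

lemma M_playoff_EdgeD:
  assumes "v \<in> {1..n}" "M (5 * J + t) v = Edge u w"
  shows "w = v \<and> u \<in> neighbors E v"
proof -
  have "uncovered t v \<noteq> {}"
    using M_playoff_Silent assms by fastforce
  then show ?thesis
    using M_playoff_Edge[OF assms(1)] assms(2) by fastforce
qed

lemma msg_ok_playoff:
  assumes "v \<in> {1..n}"
  shows "msg_ok n (M (5 * J + t) v)"
proof (cases "uncovered t v = {}")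
  case True
  then show ?thesis
    using M_playoff_Silent[OF assms] by simp
next
  case False
  then obtain u where "M (5 * J + t) v = Edge u v" "u \<in> neighbors E v"
    using M_playoff_Edge[OF assms] by blast
  then show ?thesis
    using assms simple_graph_edge(1)[OF graph, of u v] by (simp add: neighbors_def)
qed

lemma invar_S: "invar ((s + 1) ^ J) S"
  using invar[OF alive] .

lemma exit_part_S:
  assumes "v \<in> {1..n}"
  obtains W B where "exit_part S v = components W B" "v \<in> W" "W \<subseteq> {1..n}" "B \<subseteq> known S"
    "card (nbr_comps (exit_part S v) (neighbors E v) v) < s"
proof -
  have "exit_ok S v"
    using invar_S assms inactive by (simp add: invar_def)
  then show ?thesis
    using that unfolding exit_ok_def by blast
qed

lemma finite_nbr_comps_exit:
  assumes "v \<in> {1..n}"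
  shows "finite (nbr_comps (exit_part S v) (neighbors E v) v)"
proof -
  obtain W B where "exit_part S v = components W B" "W \<subseteq> {1..n}"
    using exit_part_S[OF assms] by metis
  then have "finite (exit_part S v)"
    using finite_components finite_subset by (metis finite_atLeastAtMost)
  then show ?thesis
    using finite_subset[OF nbr_comps_subset] by blast
qed

text \<open>Each Playoff round covers a further component until none is left, and fewer than
  \<open>s\<close> are there at the start. At \<open>t = s\<close> the second alternative is
  impossible, so everything is covered.\<close>

lemma card_uncovered:
  assumes v: "v \<in> {1..n}"
  shows "uncovered t v = {} \<or> card (uncovered t v) + t < s"
proof (induction t)
  case 0
  have "uncovered 0 v = nbr_comps (exit_part S v) (neighbors E v) v"
    by (simp add: uncovered_comps_def)
  then show ?case
    using exit_part_S[OF v] by (metis add_0_right)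
next
  case (Suc t)
  have sub: "uncovered (Suc t) v \<subseteq> uncovered t v"
    by (auto simp: uncovered_comps_def)
  show ?case
  proof (cases "uncovered t v = {}")
    case True
    then show ?thesis
      using sub by blast
  next
    case False
    then obtain u C where u: "M (5 * J + t) v = Edge u v" "C \<in> uncovered t v" "u \<in> C"
      using M_playoff_Edge[OF v] by blast
    then have "C \<notin> uncovered (Suc t) v"
      by (auto simp: uncovered_comps_def)
    then have "uncovered (Suc t) v \<subset> uncovered t v"
      using sub u(2) by blast
    moreover have "finite (uncovered t v)"
      by (rule finite_subset[OF _ finite_nbr_comps_exit[OF v]]) (auto simp: uncovered_comps_def)
    ultimately have "card (uncovered (Suc t) v) < card (uncovered t v)"
      by (intro psubset_card_mono)
    then show ?thesis
      using Suc False by auto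
  qed
qed

text \<open>The graph from which \<open>broadcast_cc_result\<close> extracts its forest.\<close>

definition G :: "nat set set" where
  "G = known S \<union> \<Union>(broadcast_edges n ` set (H s))"

lemma G_subset: "G \<subseteq> E"
proof -
  have "broadcast_edges n (M i) \<subseteq> E" if i: "i \<in> {5 * J..<5 * J + s}" for i
  proof -
    obtain t where "i = 5 * J + t"
      using i by (metis atLeastLessThan_iff le_iff_add)
    then show ?thesis
      using M_playoff_EdgeD[of _ t] unfolding broadcast_edges_def neighbors_def by blast
  qed
  moreover have "set (H s) = M ` {5 * J..<5 * J + s}"
    by simp
  moreover have "known S \<subseteq> E"
    using invar_S by (simp add: invar_def)
  ultimately show ?thesis
    unfolding G_def by (simp add: UN_subset_iff)
qed

text \<open>Components of the exit partition are connected by known edges, so one Playoff edge from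
  \<open>v\<close> into the component of \<open>u\<close> is enough; it may end at another node than
  \<open>u\<close>.\<close>

lemma G_connects_exit:
  assumes v: "v \<in> {1..n}" and u: "u \<in> neighbors E v" "u \<in> \<Union>(exit_part S v)"
  shows "(u, v) \<in> reachable_in {1..n} G"
proof -
  obtain W B where P: "exit_part S v = components W B" and W: "v \<in> W" "W \<subseteq> {1..n}" "B \<subseteq> known S"
    using exit_part_S[OF v] by metis
  have reach: "(x, y) \<in> reachable_in {1..n} G" if "C \<in> components W B" "x \<in> C" "y \<in> C" for C x y
    using component_mem_iff[OF that(1,2)] that(3) reachable_in_mono[of W "{1..n}" B G] W
    by (auto simp: G_def)
  obtain C where C: "C \<in> components W B" "u \<in> C"
    using u(2) unfolding P by blast
  show ?thesis
  proof (cases "v \<in> C")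
    case True
    then show ?thesis
      using reach C by blast
  next
    case False
    then have "C \<noteq> comp_of (exit_part S v) v"
      using comp_of_components(2)[OF W(1)] P by auto
    then have "C \<in> nbr_comps (exit_part S v) (neighbors E v) v"
      using C P u(1) by (auto simp: nbr_comps_def)
    moreover have "uncovered s v = {}"
      using card_uncovered[OF v, of s] by simp
    ultimately obtain m x where m: "m \<in> set (H s)" "x \<in> C" "m v = Edge x v"
      unfolding uncovered_comps_def by blast
    then have "{x, v} \<in> broadcast_edges n m"
      using v unfolding broadcast_edges_def by blast
    then have "{x, v} \<in> G"
      unfolding G_def using m(1) by blast
    then have "(x, v) \<in> reachable_in {1..n} G"
      using v m(2) C(1) W(2) component_subset by (intro reachable_in_edge) blast+
    then show ?thesis
      using reach[OF C m(2)] reachable_in_trans by blast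
  qed
qed

text \<open>For an edge of \<open>E\<close>, the last conjunct of \<open>invar\<close> supplies an
  endpoint whose exit partition contains the other one, and \<open>G_connects_exit\<close> applies
  to that endpoint.\<close>

lemma components_G: "components {1..n} G = components {1..n} E"
proof (rule components_cong_reachable, rule equalityI)
  show "reachable_in {1..n} G \<subseteq> reachable_in {1..n} E"
    using G_subset by (intro reachable_in_mono) auto
  show "reachable_in {1..n} E \<subseteq> reachable_in {1..n} G"
  proof (rule reachable_in_subsetI)
    fix u v
    assume uv: "u \<in> {1..n}" "v \<in> {1..n}" "{u, v} \<in> E"
    then have nb: "u \<in> neighbors E v" "v \<in> neighbors E u"
      by (simp_all add: neighbors_def insert_commute)
    have "u \<in> \<Union>(exit_part S v) \<or> v \<in> \<Union>(exit_part S u)"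
      using invar_S uv(1,2) inactive by (simp add: invar_def)
    then show "(u, v) \<in> reachable_in {1..n} G"
      using G_connects_exit uv(1,2) nb reachable_in_sym by blast
  qed
qed

section \<open>Correctness and complexity of the complete run\<close>

lemma solves:
  assumes s: "s \<ge> 2"
  shows "bcc_solves (broadcast_cc s pick) enc_msg n E (spanning_forest n E)
    (7 * log 2 (real n + 1)) (5 * (real s + log (real s) (real n)))"
  unfolding bcc_solves_def
proof (intro exI conjI ballI allI impI)
  define out where "out = (SOME F. spanning_forest n G F)"
  have "spanning_forest n G out"
    unfolding out_def
    by (rule someI_ex, rule spanning_forest_exists, rule simple_graph_subset[OF graph G_subset])
  then show "spanning_forest n E out"
    using G_subset components_G by (auto simp: spanning_forest_def)
  \<comment> \<open>As \<open>n \<ge> 1\<close>, some node is active initially, so there is a last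
    phase, with index \<open>J - 1\<close>.\<close>
  have J: "J \<noteq> 0"
    using inactive n by (auto simp: initial_state_def intro: ccontr)
  \<comment> \<open>The last phase started with an active node, so the size bound holds with
    exponent \<open>J - 1\<close>; lowering the base to \<open>s\<close> fits the logarithm.\<close>
  have "(s + 1) ^ (J - 1) \<le> n"
    using alive J by (intro active_bound) (auto simp: alive_def)
  moreover have "s ^ (J - 1) \<le> (s + 1) ^ (J - 1)"
    by (intro power_mono) auto
  ultimately have "real (s ^ (J - 1)) \<le> real n"
    by (intro of_nat_mono) linarith
  then have "log (real s) (real s ^ (J - 1)) \<le> log (real s) (real n)"
    using s n by (subst log_le_cancel_iff) auto
  then have "real (J - 1) \<le> log (real s) (real n)"
    using s by (simp add: log_nat_power)
  \<comment> \<open>\<open>J - 1 \<le> log s n\<close> bounds the total by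
    \<open>5 + s + 5 * log s n\<close>, and \<open>5 + s \<le> 5 * s\<close> for
    \<open>s \<ge> 2\<close>.\<close>
  then show "real (5 * J + s) \<le> 5 * (real s + log (real s) (real n))"
    using s J by (simp add: of_nat_diff)
  fix v
  assume v: "v \<in> {1..n}"
  show "result (broadcast_cc s pick) (view_of n E (tr (5 * J + s)) v) = Some out"
    using locate_playoff[OF alive inactive, of s] inactive
    by (simp add: broadcast_cc_def broadcast_cc_result_def view_of_def out_def G_def)
  fix i
  assume i: "i < 5 * J + s"
  \<comment> \<open>No node stops early: before the Playoff there are active nodes, and within it
    fewer than \<open>s\<close> of its rounds have been heard.\<close>
  have "result (broadcast_cc s pick) (view_of n E (tr i) v) = None \<and> msg_ok n (M i v)"
  proof (cases "i < 5 * J")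
    case True
    define q t where "q = i div 5" and "t = i mod 5"
    have it: "i = 5 * q + t" "t < 5" "q < J"
      using True by (auto simp: q_def t_def)
    then have al: "alive (Suc q)"
      using alive by (auto simp: alive_def)
    then have "active (st q) \<noteq> {}"
      by (simp add: alive_def)
    then show ?thesis
      using locate_phase[OF al it(2)] msg_ok_phase[OF al v it(2)] it(1)
      by (simp add: broadcast_cc_def broadcast_cc_result_def view_of_def)
  next
    case False
    define t where "t = i - 5 * J"
    have it: "i = 5 * J + t" "t < s"
      using False i by (auto simp: t_def)
    then show ?thesis
      using locate_playoff[OF alive inactive, of t] msg_ok_playoff[OF v, of t]
      by (simp add: broadcast_cc_def broadcast_cc_result_def view_of_def)
  qed
  then show "result (broadcast_cc s pick) (view_of n E (tr i) v) = None"
    and "real (length (enc_msg (message (broadcast_cc s pick) (view_of n E (tr i) v))))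
      \<le> 7 * log 2 (real n + 1)"
    using length_enc_msg[of n "M i v"] n v by (auto simp: M_def)
qed

end

theorem theorem2:
  shows "\<exists>(c_bits :: real) (c_rounds :: real) (enc :: msg \<Rightarrow> bool list). inj enc \<and>
    (\<forall>(s :: nat) (n :: nat) (E :: nat set set) (pick :: pick_rule).
       s \<ge> 2 \<longrightarrow> n \<ge> 1 \<longrightarrow> simple_graph n E \<longrightarrow>
       (\<forall>V X. X \<noteq> {} \<longrightarrow> pick V X \<in> X) \<longrightarrow>
       bcc_solves (broadcast_cc s pick) enc n E (spanning_forest n E)
         (c_bits * log 2 (real n + 1))
         (c_rounds * (real s + log (real s) (real n))))"
proof (intro exI conjI allI impI)
  \<comment> \<open>The witnesses for the two constants are 7 and 5, fixed by the final
    \<open>show\<close>; 5 is the number of rounds per phase.\<close>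
  show "inj enc_msg"
    by (rule inj_enc_msg)
  fix s n :: nat and E :: "nat set set" and pick :: pick_rule
  assume *: "s \<ge> 2" "n \<ge> 1" "simple_graph n E" "\<forall>V X. X \<noteq> {} \<longrightarrow> pick V X \<in> X"
  then interpret run s n E pick
    by unfold_locales auto
  obtain J where "alive J" "active (st J) = {}"
    using eventually_inactive * by force
  then interpret playoff s n E pick J
    by unfold_locales
  show "bcc_solves (broadcast_cc s pick) enc_msg n E (spanning_forest n E)
      (7 * log 2 (real n + 1)) (5 * (real s + log (real s) (real n)))"
    using solves * by blast
qed

end
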